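(* Let $D=(V,A)$ be a digraph, $E\subseteq V$ and $T\subseteq V$, so that $(D,T,E)$ is a representation of the gammoid $\Gamma(D,T,E)$. Suppose that $T\subseteq E$, that every $e\in E\setminus T$ is a source of $D$, and that every $t\in T$ is a sink of $D$. Then $(D,T,E)$ is a duality respecting representation, i.e. \[ \Gamma(D^{\mathrm{opp}},E\setminus T,E)=\left(\Gamma(D,T,E)\right)^{\ast}, \] where $(\cdot)^\ast$ denotes the dual matroid.
   Context: Matroids are pairs $M=(E,\mathcal{I})$ with $E$ a finite set and $\mathcal{I}$ the family of independent subsets of $E$. A digraph is a pair $D=(V,A)$ with $V$ a finite set and $A\subseteq V\times V$ (loops allowed, no parallel arcs). The opposite digraph is $D^{\mathrm{opp}}=(V,A^{\mathrm{opp}})$, where $(u,v)\in A^{\mathrm{opp}}$ if and only if $(v,u)\in A$. A vertex is a source if no arc enters it, and a sink if no arc leaves it. A path in $D$ is a non-empty, non-repeating sequence $p=(p_1p_2\ldots p_n)$ of vertices with $(p_i,p_{i+1})\in A$ for $1\le i<n$ (single-vertex paths are allowed); $p_{-1}$ denotes its last vertex $p_n$, and $|p|=\{p_1,\ldots,p_n\}$. For $X,Y\subseteq V$, a routing from $X$ to $Y$ in $D$ is a set $R$ of paths in $D$ such that (i) for each $x\in X$ there is $p\in R$ with $p_1=x$; (ii) $p_{-1}\in Y$ for all $p\in R$; (iii) for all $p,q\in R$, either $p=q$ or $|p|\cap|q|=\emptyset$. For a digraph $D=(V,A)$ and $E,T\subseteq V$, the gammoid represented by $(D,T,E)$ is the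 matroid $\Gamma(D,T,E)=(E,\mathcal{I})$, where $\mathcal{I}$ consists of all $X\subseteq E$ for which there is a routing from $X$ to $T$ in $D$. The triple $(D,T,E)$ is called a representation of this gammoid. *)

theory Defs
  imports "Graph_Theory.Graph_Theory"
begin

text \<open>A matroid is represented by the pair of its ground set and its family of independent sets,
  and matroids are equal iff these pairs are. The operations below are total on such pairs; the
  matroid axioms are not enforced by the type.\<close>

type_synonym 'a indep_system = "'a set \<times> 'a set set"

definition basis :: "'a indep_system \<Rightarrow> 'a set \<Rightarrow> bool" where
  "basis M B \<longleftrightarrow> B \<in> snd M \<and> (\<forall>X \<in> snd M. B \<subseteq> X \<longrightarrow> X = B)"

text \<open>The bases of the dual are the complements of the bases, so its independent sets are the
  subsets of these complements.\<close>

definition dual_matroid :: "'a indep_system \<Rightarrow> 'a indep_system" where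
  "dual_matroid M = (fst M, {X. \<exists>B. basis M B \<and> X \<subseteq> fst M - B})"

definition opposite :: "'a pair_pre_digraph \<Rightarrow> 'a pair_pre_digraph" where
  "opposite D = \<lparr>pverts = pverts D, parcs = (parcs D)\<inverse>\<rparr>"

definition is_source :: "'a pair_pre_digraph \<Rightarrow> 'a \<Rightarrow> bool" where
  "is_source D v \<longleftrightarrow> v \<in> pverts D \<and> in_arcs (with_proj D) v = {}"

definition is_sink :: "'a pair_pre_digraph \<Rightarrow> 'a \<Rightarrow> bool" where
  "is_sink D v \<longleftrightarrow> v \<in> pverts D \<and> out_arcs (with_proj D) v = {}"

text \<open>Paths are the non-empty, non-repeating vertex sequences \<^const>\<open>vpath\<close>; single vertices are
  allowed. Paths of a routing need not all start in \<open>X\<close>.\<close>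

definition routing :: "'a pair_pre_digraph \<Rightarrow> 'a set \<Rightarrow> 'a set \<Rightarrow> 'a list set \<Rightarrow> bool" where
  "routing D X Y R \<longleftrightarrow>
     (\<forall>p \<in> R. vpath p (with_proj D)) \<and>
     (\<forall>x \<in> X. \<exists>p \<in> R. hd p = x) \<and>
     (\<forall>p \<in> R. last p \<in> Y) \<and>
     (\<forall>p \<in> R. \<forall>q \<in> R. p = q \<or> set p \<inter> set q = {})"

definition gammoid :: "'a pair_pre_digraph \<Rightarrow> 'a set \<Rightarrow> 'a set \<Rightarrow> 'a indep_system" where
  "gammoid D T E = (E, {X. X \<subseteq> E \<and> (\<exists>R. routing D X T R)})"

end

theory Submission
  imports Defs
begin

text \<open>Since the elements of \<open>T\<close> are sinks and those of \<open>E - T\<close> are sources, a routing from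
  \<open>X\<close> into \<open>T\<close> meets \<open>E\<close> only in end vertices of its paths. Hence the unused elements of \<open>T\<close> may be
  added as single-vertex paths, so the bases are exactly the sets linked onto all of \<open>T\<close>. If \<open>R\<close>
  links \<open>B\<close> onto \<open>T\<close>, reversing the paths of \<open>R\<close> that start outside \<open>T\<close> and adding the elements of
  \<open>E - T - B\<close> as single-vertex paths links \<open>E - B\<close> onto \<open>E - T\<close> in the opposite digraph. This
  construction is symmetric in the two digraphs.\<close>

section \<open>Opposite digraphs, and sources and sinks on paths\<close>

lemma opposite_opposite [simp]: "opposite (opposite D) = D"
  by (simp add: opposite_def)

lemma is_source_opposite [simp]: "is_source (opposite D) v \<longleftrightarrow> is_sink D v"
  by (auto simp: is_source_def is_sink_def opposite_def in_arcs_def out_arcs_def)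

lemma is_sink_opposite [simp]: "is_sink (opposite D) v \<longleftrightarrow> is_source D v"
  by (auto simp: is_source_def is_sink_def opposite_def in_arcs_def out_arcs_def)

lemma set_vwalk_arcs_rev: "set (vwalk_arcs (rev p)) = (set (vwalk_arcs p))\<inverse>"
proof (induction p rule: vwalk_arcs.induct)
  case (3 x y xs)
  have "vwalk_arcs (rev (x # y # xs)) = vwalk_arcs (rev (y # xs)) @ [(y, x)]"
    using vwalk_arcs_append[of "rev (y # xs)" "[x]"] by simp
  with 3 show ?case
    by auto
qed auto

lemma vpath_rev_opposite:
  assumes "vpath p (with_proj D)"
  shows "vpath (rev p) (with_proj (opposite D))"
  using assms by (auto simp: vpath_def vwalk_def set_vwalk_arcs_rev opposite_def)

lemma vpath_singleton:
  assumes "v \<in> pverts D"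
  shows "vpath [v] (with_proj D)"
  using assms by (auto simp: vpath_def vwalk_def)

lemma vpath_nonempty: "vpath p G \<Longrightarrow> p \<noteq> []"
  by (auto simp: vpath_def vwalk_def)

text \<open>Any vertex before the last one has a successor on the path, and the arc to that
  successor leaves it.\<close>

lemma sink_eq_last:
  assumes "is_sink D v" "vpath p (with_proj D)" "v \<in> set p"
  shows "v = last p"
proof (rule ccontr)
  assume neq: "v \<noteq> last p"
  obtain xs ys where p: "p = xs @ v # ys"
    using assms(3) by (meson split_list)
  with neq obtain y zs where "ys = y # zs"
    by (cases ys) auto
  with p have "(v, y) \<in> set (vwalk_arcs p)"
    using set_vwalk_arcs_append2[of "v # ys" xs] by auto
  then have "(v, y) \<in> parcs D"
    using assms(2) by (auto simp: vpath_def vwalk_def)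
  then show False
    using assms(1) by (auto simp: is_sink_def out_arcs_def)
qed

lemma source_eq_hd:
  assumes "is_source D v" "vpath p (with_proj D)" "v \<in> set p"
  shows "v = hd p"
  using sink_eq_last[of "opposite D" v "rev p"] assms
  by (simp add: vpath_rev_opposite last_rev vpath_nonempty)

section \<open>Disjoint paths with prescribed sets of ends\<close>

text \<open>A \<open>routing\<close> may have paths starting outside \<open>X\<close> and may miss
  elements of \<open>Y\<close>. Fixing both sets of ends exactly gives a notion that survives
  reversal of all paths.\<close>

definition linking :: "'a pair_pre_digraph \<Rightarrow> 'a set \<Rightarrow> 'a set \<Rightarrow> 'a list set \<Rightarrow> bool" where
  "linking D X Y R \<longleftrightarrow> routing D X Y R \<and> hd ` R = X \<and> last ` R = Y"

lemma linking_iff: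
  "linking D X Y R \<longleftrightarrow>
     (\<forall>p \<in> R. vpath p (with_proj D)) \<and> hd ` R = X \<and> last ` R = Y \<and>
     (\<forall>p \<in> R. \<forall>q \<in> R. p = q \<or> set p \<inter> set q = {})"
  unfolding linking_def routing_def by blast

lemma routing_paths_eq:
  assumes "routing D X Y R" "p \<in> R" "q \<in> R" "v \<in> set p" "v \<in> set q"
  shows "p = q"
  using assms unfolding routing_def by blast

text \<open>Disjointness makes each path determined by its first vertex and also by its last, so
  \<open>R\<close> is in bijection with both sets.\<close>

lemma linking_card_eq:
  assumes "linking D X Y R"
  shows "card X = card Y"
proof -
  have R: "routing D X Y R"
    using assms by (simp add: linking_def)
  then have ne: "p \<noteq> []" if "p \<in> R" for p
    using that by (auto simp: routing_def dest: vpath_nonempty)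
  have "inj_on hd R"
    using ne by (intro inj_onI) (metis R hd_in_set routing_paths_eq)
  moreover have "inj_on last R"
    using ne by (intro inj_onI) (metis R last_in_set routing_paths_eq)
  ultimately show ?thesis
    using assms by (metis card_image linking_def)
qed

section \<open>Independent sets and bases in terms of linkings\<close>

text \<open>This form of the hypotheses is preserved when \<open>D\<close> is replaced by
  \<open>opposite D\<close> and \<open>T\<close> by \<open>E - T\<close>. It puts \<open>E\<close>
  inside \<open>pverts D\<close>, since sources and sinks are vertices by definition.\<close>

definition bipolar_rep :: "'a pair_pre_digraph \<Rightarrow> 'a set \<Rightarrow> 'a set \<Rightarrow> bool" where
  "bipolar_rep D T E \<longleftrightarrow>
     T \<subseteq> E \<and> (\<forall>e \<in> E - T. is_source D e) \<and> (\<forall>t \<in> T. is_sink D t)"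

lemma bipolar_rep_opposite:
  assumes "bipolar_rep D T E"
  shows "bipolar_rep (opposite D) (E - T) E"
  using assms by (auto simp: bipolar_rep_def)

lemma bipolar_rep_vpath_singleton:
  assumes "bipolar_rep D T E" "e \<in> E"
  shows "vpath [e] (with_proj D)"
  using assms by (intro vpath_singleton) (auto simp: bipolar_rep_def is_source_def is_sink_def)

lemma routing_extend_linking:
  assumes rep: "bipolar_rep D T E" and "X \<subseteq> E" and R: "routing D X T R"
  obtains B Q where "X \<subseteq> B" "B \<subseteq> E" "linking D B T Q"
proof -
  \<comment> \<open>Paths starting outside \<open>X\<close> are dropped, since their first vertices
    might lie outside \<open>E\<close>.\<close>
  define P where "P = {p \<in> R. hd p \<in> X}"
  define U where "U = T - last ` P"
  define Q where "Q = P \<union> (\<lambda>t. [t]) ` U"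
  have path: "vpath p (with_proj D)" "last p \<in> T" if "p \<in> P" for p
    using R that by (auto simp: routing_def P_def)
  have "X = hd ` P"
    using R by (fastforce simp: routing_def P_def)
  \<comment> \<open>An element of \<open>U\<close> is a sink, so on \<open>p\<close> it could only
    be the last vertex, which the choice of \<open>U\<close> excludes.\<close>
  have disj_P: "t \<notin> set p" if "p \<in> P" "t \<in> U" for p t
    using that path sink_eq_last[of D t p] rep by (auto simp: U_def bipolar_rep_def)
  have paths_P: "p = q \<or> set p \<inter> set q = {}" if "p \<in> P" "q \<in> P" for p q
    using R that unfolding routing_def P_def by blast
  have "linking D (X \<union> U) T Q"
    unfolding linking_iff
  proof (intro conjI)
    show "\<forall>p \<in> Q. vpath p (with_proj D)"
      using path bipolar_rep_vpath_singleton[OF rep] rep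
      by (auto simp: Q_def U_def bipolar_rep_def)
    show "hd ` Q = X \<union> U"
      using \<open>X = hd ` P\<close> by (simp add: Q_def image_Un image_image)
    show "last ` Q = T"
      using path by (auto simp: Q_def U_def image_Un image_image)
    show "\<forall>p \<in> Q. \<forall>q \<in> Q. p = q \<or> set p \<inter> set q = {}"
      unfolding Q_def using paths_P disj_P by fastforce
  qed
  moreover have "X \<union> U \<subseteq> E"
    using \<open>X \<subseteq> E\<close> rep by (auto simp: U_def bipolar_rep_def)
  ultimately show thesis
    using that by blast
qed

lemma gammoid_indep_iff:
  assumes "bipolar_rep D T E"
  shows "X \<in> snd (gammoid D T E) \<longleftrightarrow> (\<exists>B R. X \<subseteq> B \<and> B \<subseteq> E \<and> linking D B T R)"
proof
  assume "X \<in> snd (gammoid D T E)"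
  then obtain R where "X \<subseteq> E" "routing D X T R"
    by (auto simp: gammoid_def)
  then show "\<exists>B R. X \<subseteq> B \<and> B \<subseteq> E \<and> linking D B T R"
    by (rule routing_extend_linking[OF assms]) blast
next
  assume "\<exists>B R. X \<subseteq> B \<and> B \<subseteq> E \<and> linking D B T R"
  then obtain B R where B: "X \<subseteq> B" "B \<subseteq> E" "routing D B T R"
    unfolding linking_def by blast
  then have "routing D X T R"
    unfolding routing_def by (meson subsetD)
  with B show "X \<in> snd (gammoid D T E)"
    by (auto simp: gammoid_def)
qed

text \<open>All sets linked onto \<open>T\<close> have the cardinality of \<open>T\<close>, so in
  the finite set \<open>E\<close> none of them properly contains another.\<close>

lemma gammoid_basis_iff:
  assumes rep: "bipolar_rep D T E" and "finite E"
  shows "basis (gammoid D T E) B \<longleftrightarrow> B \<subseteq> E \<and> (\<exists>R. linking D B T R)"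
proof
  assume B: "basis (gammoid D T E) B"
  then obtain C R where C: "B \<subseteq> C" "C \<subseteq> E" "linking D C T R"
    unfolding basis_def gammoid_indep_iff[OF rep] by blast
  then have "C \<in> snd (gammoid D T E)"
    unfolding gammoid_indep_iff[OF rep] by blast
  with B C(1) have "C = B"
    by (auto simp: basis_def)
  with C show "B \<subseteq> E \<and> (\<exists>R. linking D B T R)"
    by blast
next
  assume B: "B \<subseteq> E \<and> (\<exists>R. linking D B T R)"
  have "X = B" if X: "X \<in> snd (gammoid D T E)" and "B \<subseteq> X" for X
  proof -
    obtain C R where C: "X \<subseteq> C" "C \<subseteq> E" "linking D C T R"
      using X unfolding gammoid_indep_iff[OF rep] by blast
    then have "card C = card B"
      using B linking_card_eq by metis
    then have "B = C"
      using C \<open>B \<subseteq> X\<close> \<open>finite E\<close> by (metis card_subset_eq finite_subset order_trans)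
    with C \<open>B \<subseteq> X\<close> show ?thesis
      by blast
  qed
  moreover have "B \<in> snd (gammoid D T E)"
    unfolding gammoid_indep_iff[OF rep] using B by blast
  ultimately show "basis (gammoid D T E) B"
    by (simp add: basis_def)
qed

section \<open>Complements of linked sets\<close>

lemma linking_complement:
  assumes rep: "bipolar_rep D T E" and "B \<subseteq> E" and R: "linking D B T R"
  shows "\<exists>Q. linking (opposite D) (E - B) (E - T) Q"
proof -
  \<comment> \<open>A path of \<open>R\<close> starting in \<open>T\<close> starts at a sink, hence
    is a single vertex of \<open>B \<inter> T\<close>. Such a vertex lies in neither
    \<open>E - B\<close> nor \<open>E - T\<close>, so the path is discarded.\<close>
  define P where "P = {p \<in> R. hd p \<notin> T}"
  define U where "U = E - B - T"
  define Q where "Q = rev ` P \<union> (\<lambda>e. [e]) ` U"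
  have hd_R: "hd ` R = B" and last_R: "last ` R = T" and rout: "routing D B T R"
    using R by (auto simp: linking_def)
  have path: "vpath p (with_proj D)" "p \<noteq> []" if "p \<in> R" for p
    using R that by (auto simp: linking_iff dest: vpath_nonempty)
  have sink: "is_sink D t" if "t \<in> T" for t
    using rep that by (auto simp: bipolar_rep_def)
  have disj_P: "e \<notin> set p" if "p \<in> P" "e \<in> U" for p e
  proof
    assume "e \<in> set p"
    moreover have "is_source D e"
      using rep \<open>e \<in> U\<close> by (auto simp: U_def bipolar_rep_def)
    ultimately have "e = hd p"
      using source_eq_hd[of D e p] path(1) \<open>p \<in> P\<close> by (auto simp: P_def)
    with that hd_R show False
      by (auto simp: P_def U_def)
  qed
  have last_P: "last ` P = T - B"
  proof (intro equalityI subsetI)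
    fix t assume "t \<in> last ` P"
    then obtain p where p: "p \<in> R" "hd p \<notin> T" "t = last p"
      by (auto simp: P_def)
    \<comment> \<open>Otherwise \<open>t\<close> is also the first vertex of a path, which by
      disjointness is \<open>p\<close> itself, so that \<open>hd p = t\<close> lies in
      \<open>T\<close>.\<close>
    have "t \<notin> B"
    proof
      assume "t \<in> B"
      then obtain q where "q \<in> R" "t = hd q"
        using hd_R by blast
      with p have "p = q"
        using routing_paths_eq[OF rout] path by (metis hd_in_set last_in_set)
      with p \<open>t = hd q\<close> last_R show False
        by auto
    qed
    with p last_R show "t \<in> T - B"
      by blast
  next
    fix t assume t: "t \<in> T - B"
    then obtain p where p: "p \<in> R" "t = last p"
      using last_R by blast
    have "hd p \<notin> T"
    proof
      assume "hd p \<in> T"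
      then have "hd p = t"
        using sink_eq_last[OF sink, of "hd p" p] path p by simp
      with p(1) t hd_R show False
        by blast
    qed
    with p show "t \<in> last ` P"
      by (simp add: P_def)
  qed
  have hd_P: "hd ` P = B - T"
    using hd_R by (auto simp: P_def)
  have ends: "hd ` rev ` P = last ` P" "last ` rev ` P = hd ` P"
    using path by (auto simp: P_def image_image hd_rev last_rev intro!: image_cong)
  have paths_P: "p = q \<or> set p \<inter> set q = {}" if "p \<in> P" "q \<in> P" for p q
    using rout that unfolding routing_def P_def by blast
  \<comment> \<open>The paths of \<open>Q\<close> start in \<open>(T - B) \<union> U = E - B\<close>
    and end in \<open>(B - T) \<union> U = E - T\<close>.\<close>
  have "linking (opposite D) (E - B) (E - T) Q"
    unfolding linking_iff
  proof (intro conjI)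
    show "\<forall>p \<in> Q. vpath p (with_proj (opposite D))"
      using path(1) bipolar_rep_vpath_singleton[OF bipolar_rep_opposite[OF rep]]
      by (auto simp: Q_def P_def U_def intro: vpath_rev_opposite)
    show "hd ` Q = E - B"
      using rep last_P ends by (auto simp: Q_def U_def image_Un image_image bipolar_rep_def)
    show "last ` Q = E - T"
      using \<open>B \<subseteq> E\<close> hd_P ends by (auto simp: Q_def U_def image_Un image_image)
    show "\<forall>p \<in> Q. \<forall>q \<in> Q. p = q \<or> set p \<inter> set q = {}"
      unfolding Q_def using paths_P disj_P by fastforce
  qed
  then show ?thesis
    by blast
qed

theorem lemma2p2:
  fixes D :: "'a pair_pre_digraph" and E T :: "'a set"
  assumes "pair_fin_digraph D"
    and "E \<subseteq> pverts D"
    and "T \<subseteq> pverts D"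
    and "T \<subseteq> E"
    and "\<And>e. e \<in> E - T \<Longrightarrow> is_source D e"
    and "\<And>t. t \<in> T \<Longrightarrow> is_sink D t"
  shows "gammoid (opposite D) (E - T) E = dual_matroid (gammoid D T E)"
proof -
  have rep: "bipolar_rep D T E"
    using assms by (simp add: bipolar_rep_def)
  note opp = bipolar_rep_opposite[OF rep]
  have "finite (pverts D)"
    using assms(1) by (simp add: pair_fin_digraph_def pair_fin_digraph_axioms_def)
  with assms(2) have "finite E"
    by (rule finite_subset)
  have "E - (E - T) = T"
    using assms(4) by blast
  \<comment> \<open>Complementation applied to the opposite representation leads back to
    \<open>D\<close> and \<open>T\<close>, because both operations are involutions here.\<close>
  then have compl: "\<exists>R. linking D (E - C) T R"
    if "C \<subseteq> E" "linking (opposite D) C (E - T) Q" for C Q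
    using linking_complement[OF opp that] by simp
  have "X \<in> snd (gammoid (opposite D) (E - T) E) \<longleftrightarrow>
      (\<exists>B. basis (gammoid D T E) B \<and> X \<subseteq> E - B)" for X
  proof
    assume "X \<in> snd (gammoid (opposite D) (E - T) E)"
    then obtain C Q where C: "X \<subseteq> C" "C \<subseteq> E" "linking (opposite D) C (E - T) Q"
      unfolding gammoid_indep_iff[OF opp] by blast
    then have "basis (gammoid D T E) (E - C)"
      unfolding gammoid_basis_iff[OF rep \<open>finite E\<close>] using compl by blast
    with C show "\<exists>B. basis (gammoid D T E) B \<and> X \<subseteq> E - B"
      by blast
  next
    assume "\<exists>B. basis (gammoid D T E) B \<and> X \<subseteq> E - B"
    then obtain B R where B: "X \<subseteq> E - B" "B \<subseteq> E" "linking D B T R"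
      unfolding gammoid_basis_iff[OF rep \<open>finite E\<close>] by blast
    then obtain Q where "linking (opposite D) (E - B) (E - T) Q"
      using linking_complement[OF rep] by metis
    with B show "X \<in> snd (gammoid (opposite D) (E - T) E)"
      unfolding gammoid_indep_iff[OF opp] by blast
  qed
  then show ?thesis
    by (intro prod_eqI set_eqI) (simp_all add: dual_matroid_def gammoid_def)
qed

end
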